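(* Almost all monotone Boolean functions are evasive; that is, the proportion of monotone Boolean functions $f:\{0,1\}^n\to\{0,1\}$ that are evasive tends to $1$ as $n\to\infty$.
   Context: A Boolean function is a function $f:\{0,1\}^n\to\{0,1\}$. It is monotone if $f(x_1,\dots,x_n)\leq f(y_1,\dots,y_n)$ whenever $x_i\leq y_i$ for all $i$. The decision tree complexity $D(f)$ is the minimum, over all deterministic adaptive query algorithms computing $f$, of the worst-case number of queries: the algorithm initially has no information about the input $x=(x_1,\dots,x_n)$, at each stage asks a question of the form "what is $x_i$?" (the choice of $i$ may depend on previous answers), and terminates when it knows the value $f(x)$; $D(f)\leq t$ if some algorithm terminates after at most $t$ questions for all inputs $x$. Always $D(f)\le n$, and $f$ is called evasive if $D(f)=n$. *)

theory Defs
  imports Complex_Main "HOL-Library.FuncSet"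
begin

text \<open>Truth values are rendered by \<^typ>\<open>bool\<close> with \<^prop>\<open>False < True\<close>. The coordinates are
  numbered \<open>0, \<dots>, n - 1\<close>. Points of the cube and Boolean functions are extensional, so that
  each is represented exactly once and cardinalities are the intended ones.\<close>

definition cube :: "nat \<Rightarrow> (nat \<Rightarrow> bool) set" where
  "cube n = {..<n} \<rightarrow>\<^sub>E UNIV"

definition boolean_functions :: "nat \<Rightarrow> ((nat \<Rightarrow> bool) \<Rightarrow> bool) set" where
  "boolean_functions n = cube n \<rightarrow>\<^sub>E UNIV"

text \<open>The order on points is the pointwise order on functions: two points of the cube agree
  outside \<open>{..<n}\<close>, so it amounts to the coordinatewise order on the first \<open>n\<close> coordinates.\<close>

definition monotone_boolean_functions :: "nat \<Rightarrow> ((nat \<Rightarrow> bool) \<Rightarrow> bool) set" where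
  "monotone_boolean_functions n = {f \<in> boolean_functions n. mono_on (cube n) f}"

text \<open>A deterministic adaptive query algorithm: \<open>Query i T0 T1\<close> asks for the value of \<open>x i\<close> and
  continues with \<open>T0\<close> if the answer is \<^const>\<open>False\<close> and with \<open>T1\<close> if it is \<^const>\<open>True\<close>;
  \<open>Answer b\<close> terminates, announcing the value \<open>b\<close>.\<close>

datatype dtree = Answer bool | Query nat dtree dtree

primrec queried_vars :: "dtree \<Rightarrow> nat set" where
  "queried_vars (Answer b) = {}"
| "queried_vars (Query i T0 T1) = insert i (queried_vars T0 \<union> queried_vars T1)"

primrec run :: "dtree \<Rightarrow> (nat \<Rightarrow> bool) \<Rightarrow> bool" where
  "run (Answer b) x = b"
| "run (Query i T0 T1) x = (if x i then run T1 x else run T0 x)"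

primrec num_queries :: "dtree \<Rightarrow> (nat \<Rightarrow> bool) \<Rightarrow> nat" where
  "num_queries (Answer b) x = 0"
| "num_queries (Query i T0 T1) x = Suc (if x i then num_queries T1 x else num_queries T0 x)"

definition computes :: "nat \<Rightarrow> dtree \<Rightarrow> ((nat \<Rightarrow> bool) \<Rightarrow> bool) \<Rightarrow> bool" where
  "computes n T f \<longleftrightarrow> queried_vars T \<subseteq> {..<n} \<and> (\<forall>x\<in>cube n. run T x = f x)"

definition worst_case_queries :: "nat \<Rightarrow> dtree \<Rightarrow> nat" where
  "worst_case_queries n T = Max (num_queries T ` cube n)"

text \<open>The infimum is a minimum: it is taken in \<^typ>\<open>nat\<close>, over a set that is nonempty because
  every \<open>f\<close> is computed by the tree that queries all \<open>n\<close> coordinates.\<close>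

definition decision_tree_complexity :: "nat \<Rightarrow> ((nat \<Rightarrow> bool) \<Rightarrow> bool) \<Rightarrow> nat" where
  "decision_tree_complexity n f = (INF T\<in>{T. computes n T f}. worst_case_queries n T)"

definition evasive :: "nat \<Rightarrow> ((nat \<Rightarrow> bool) \<Rightarrow> bool) \<Rightarrow> bool" where
  "evasive n f \<longleftrightarrow> decision_tree_complexity n f = n"

end

theory Submission
  imports Defs
begin

text \<open>
  A decision tree that always stops before \<open>n\<close> queries splits the cube into subcubes of positive
  dimension on which \<open>f\<close> is constant, and such a subcube has as many points of even as of odd weight.
  So a non-evasive \<open>f\<close> has as many true points of even weight as of odd weight.

  Condition a random monotone function on its values at the points of one parity. The points of
  the other parity whose value is not yet forced then carry independent fair bits, so if there are
  \<open>m\<close> of them, balance has probability at most \<open>(m choose (m div 2)) / 2 ^ m\<close>, which tends to \<open>0\<close>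
  with \<open>m\<close>. Minimal true points are never forced, so it remains to see that there are many of them
  typically: at most about \<open>2 ^ (n * K)\<close> monotone functions have fewer than \<open>K\<close> minimal true points,
  while there are at least \<open>2 ^ (n choose 2)\<close> monotone functions, one for every set of points of weight \<open>2\<close>.
\<close>

subsection \<open>Central binomial coefficients\<close>

text \<open>The largest probability with which the sum of \<open>m\<close> independent fair bits
  takes a prescribed value.\<close>

definition central_ratio :: "nat \<Rightarrow> real" where
  "central_ratio m = real (m choose (m div 2)) / 2 ^ m"

text \<open>By Pascal's rule the middle entry of row \<open>Suc m\<close> is a sum of at most two
  entries of row \<open>m\<close>, while the power of 2 doubles.\<close>

lemma central_ratio_Suc_le: "central_ratio (Suc m) \<le> central_ratio m"
proof -
  obtain k where k: "Suc m choose (Suc m div 2) \<le> (m choose k) + (m choose (Suc m div 2))"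
    by (cases "Suc m div 2") auto
  have "Suc m choose (Suc m div 2) \<le> 2 * (m choose (m div 2))"
    using k binomial_maximum[of m k] binomial_maximum[of m "Suc m div 2"] by linarith
  then have "real (Suc m choose (Suc m div 2)) \<le> 2 * real (m choose (m div 2))"
    by (metis of_nat_le_iff of_nat_mult of_nat_numeral)
  then show ?thesis by (simp add: central_ratio_def field_simps del: binomial_Suc_Suc)
qed

lemma antimono_central_ratio: "antimono central_ratio"
  by (simp add: antimono_iff_le_Suc central_ratio_Suc_le)

text \<open>The bound is uniform in \<open>m\<close> and \<open>k\<close>, because the number of
  free points and the prescribed sum vary from fibre to fibre.\<close>

lemma binomial_le_central_ratio:
  assumes "M \<le> m"
  shows "real (m choose k) \<le> central_ratio M * 2 ^ m"
proof -
  have "real (m choose k) \<le> central_ratio m * 2 ^ m"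
    by (simp add: central_ratio_def binomial_maximum)
  also have "\<dots> \<le> central_ratio M * 2 ^ m"
    using antimonoD[OF antimono_central_ratio assms] by (intro mult_right_mono) auto
  finally show ?thesis .
qed

section \<open>Decay of the central binomial ratio\<close>

lemma Suc_times_central_binomial:
  "Suc m * (2 * Suc m choose Suc m) = 2 * (2 * m + 1) * (2 * m choose m)"
proof -
  have "Suc m * (Suc (Suc (2 * m)) choose Suc m) = Suc (Suc (2 * m)) * (Suc (2 * m) choose m)"
    using Suc_times_binomial_eq[of "Suc (2 * m)" m] by (simp only: mult.commute)
  also have "Suc (2 * m) choose m = Suc (2 * m) choose Suc m"
    using binomial_symmetric[of m "Suc (2 * m)"] by (simp del: binomial_Suc_Suc)
  finally have "Suc m * (Suc (Suc (2 * m)) choose Suc m) = 2 * (Suc m * (Suc (2 * m) choose Suc m))"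
    by (simp del: binomial_Suc_Suc)
  also have "Suc m * (Suc (2 * m) choose Suc m) = Suc (2 * m) * (2 * m choose m)"
    using Suc_times_binomial_eq[of "2 * m" m] by (simp only: mult.commute)
  finally show ?thesis by (simp del: binomial_Suc_Suc)
qed

text \<open>This says \<open>central_ratio (2 * m)\<close> is at most 1 / sqrt (2m + 1), squared so
  as to stay in the naturals. The factor \<open>2 * m + 1\<close> makes the induction close, since
  (2m + 1)(2m + 3) <= (2m + 2)^2.\<close>

lemma central_binomial_square_le: "(2 * m + 1) * (2 * m choose m)\<^sup>2 \<le> 16 ^ m"
proof (induction m)
  case (Suc m)
  let ?b = "2 * m choose m" and ?c = "2 * Suc m choose Suc m"
  have coeff: "2 * Suc m + 1 = 2 * m + 3" by simp
  have "(Suc m)\<^sup>2 * ((2 * Suc m + 1) * ?c\<^sup>2) = (2 * m + 3) * (Suc m * ?c)\<^sup>2"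
    unfolding coeff by (simp only: power_mult_distrib mult_ac)
  also have "\<dots> = (4 * (2 * m + 1) * (2 * m + 3)) * ((2 * m + 1) * ?b\<^sup>2)"
    unfolding Suc_times_central_binomial by (simp add: power2_eq_square algebra_simps)
  also have "\<dots> \<le> (16 * (Suc m)\<^sup>2) * 16 ^ m"
    using Suc.IH by (rule mult_mono[rotated]) (auto simp: power2_eq_square algebra_simps)
  finally have "(Suc m)\<^sup>2 * ((2 * Suc m + 1) * ?c\<^sup>2) \<le> (Suc m)\<^sup>2 * 16 ^ Suc m"
    by (simp add: mult_ac del: binomial_Suc_Suc)
  then show ?case by (simp del: binomial_Suc_Suc)
qed auto

lemma central_ratio_small:
  assumes "0 < e"
  shows "\<exists>M. central_ratio M < e"
proof -
  obtain m where m: "1 / e\<^sup>2 < real m" using reals_Archimedean2 by blast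
  have "real ((2 * m + 1) * (2 * m choose m)\<^sup>2) \<le> real (16 ^ m)"
    using central_binomial_square_le of_nat_le_iff by blast
  moreover have "(2 ^ (2 * m))\<^sup>2 = (16::real) ^ m"
    by (simp add: power_mult flip: power_mult_distrib) (simp flip: power_mult_distrib add: power2_eq_square)
  ultimately have le: "(2 * real m + 1) * (central_ratio (2 * m))\<^sup>2 \<le> 1"
    by (simp add: central_ratio_def power_divide algebra_simps)
  have "1 < real m * e\<^sup>2" using m assms by (simp add: field_simps)
  also have "\<dots> \<le> (2 * real m + 1) * e\<^sup>2" by (intro mult_right_mono) auto
  finally have "1 < (2 * real m + 1) * e\<^sup>2" .
  then have "(2 * real m + 1) * (central_ratio (2 * m))\<^sup>2 < (2 * real m + 1) * e\<^sup>2"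
    using le by linarith
  then have "(central_ratio (2 * m))\<^sup>2 < e\<^sup>2"
    by (rule mult_left_less_imp_less) auto
  then have "central_ratio (2 * m) < e"
    using assms by (auto intro: power_less_imp_less_base)
  then show ?thesis ..
qed

subsection \<open>Upsets of a coloured finite order\<close>

definition upsets :: "'a::order set \<Rightarrow> 'a set set" where
  "upsets C = {U. U \<subseteq> C \<and> (\<forall>x\<in>U. \<forall>y\<in>C. x \<le> y \<longrightarrow> y \<in> U)}"

definition minimal_elements :: "'a::order set \<Rightarrow> 'a set" where
  "minimal_elements U = {x \<in> U. \<forall>y\<in>U. \<not> y < x}"

definition balanced :: "('a \<Rightarrow> bool) \<Rightarrow> 'a set \<Rightarrow> bool" where
  "balanced p U \<longleftrightarrow> card {x \<in> U. p x} = card {x \<in> U. \<not> p x}"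

text \<open>The points of colour \<open>p\<close> whose membership in an upset is left open by the part \<open>V\<close> of that
  upset lying outside \<open>p\<close>.\<close>

definition free_points :: "('a::order) set \<Rightarrow> ('a \<Rightarrow> bool) \<Rightarrow> 'a set \<Rightarrow> 'a set" where
  "free_points C p V =
    {x \<in> C. p x \<and> (\<forall>y\<in>C. \<not> p y \<longrightarrow> (y < x \<longrightarrow> y \<notin> V) \<and> (x < y \<longrightarrow> y \<in> V))}"

lemma finite_upsets: "finite C \<Longrightarrow> finite (upsets C)"
  by (rule finite_subset[of _ "Pow C"]) (auto simp: upsets_def)

text \<open>\<open>B\<close> collects the points forced into the upset: \<open>V\<close> and the
  points of colour \<open>p\<close> above it. The remaining choices are independent, since by
  \<open>between\<close> two comparable points of colour \<open>p\<close> have a point of the other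
  colour between them, so that no free point forces another. \<open>U0\<close> witnesses that
  \<open>V\<close> comes from an upset.\<close>

lemma upset_fibre:
  assumes U0: "U0 \<in> upsets C"
    and between: "\<And>x y. \<lbrakk>x \<in> C; y \<in> C; x < y; p x; p y\<rbrakk> \<Longrightarrow> \<exists>z\<in>C. \<not> p z \<and> x < z \<and> z < y"
  defines "V \<equiv> {x \<in> U0. \<not> p x}"
  defines "B \<equiv> V \<union> {x \<in> C. p x \<and> (\<exists>y\<in>V. y < x)}"
  shows "{U \<in> upsets C. {x \<in> U. \<not> p x} = V} = (\<lambda>S. B \<union> S) ` Pow (free_points C p V)"
proof (intro equalityI subsetI)
  fix U assume "U \<in> {U \<in> upsets C. {x \<in> U. \<not> p x} = V}"
  then have U: "U \<subseteq> C" "\<And>x y. x \<in> U \<Longrightarrow> y \<in> C \<Longrightarrow> x \<le> y \<Longrightarrow> y \<in> U"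
    and V: "V = {x \<in> U. \<not> p x}" by (auto simp: upsets_def)
  have "B \<subseteq> U" using U by (auto simp: B_def V order_less_imp_le)
  moreover have "U - B \<subseteq> free_points C p V"
    using U by (auto simp: B_def V free_points_def order_less_imp_le)
  ultimately show "U \<in> (\<lambda>S. B \<union> S) ` Pow (free_points C p V)"
    by (intro image_eqI[of _ _ "U - B"]) auto
next
  fix U assume "U \<in> (\<lambda>S. B \<union> S) ` Pow (free_points C p V)"
  then obtain S where S: "S \<subseteq> free_points C p V" and U: "U = B \<union> S" by auto
  have sub: "U0 \<subseteq> C" and up: "\<And>x y. x \<in> U0 \<Longrightarrow> y \<in> C \<Longrightarrow> x \<le> y \<Longrightarrow> y \<in> U0"
    using U0 by (auto simp: upsets_def)
  have B: "y \<in> B" if "x \<in> V" "y \<in> C" "x \<le> y" for x y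
    using that up[of x y] by (auto simp: B_def V_def order_le_less)
  have "y \<in> U" if x: "x \<in> U" and y: "y \<in> C" "x \<le> y" for x y
  proof -
    consider "x \<in> B" | "x = y" | "x \<in> S" "x < y" using x y U by fastforce
    then show ?thesis
    proof cases
      case 1
      then obtain z where "z \<in> V" "z \<le> x" by (auto simp: B_def order_less_imp_le)
      then show ?thesis using B[of z y] y U by auto
    next
      case 2
      then show ?thesis using x by simp
    next
      case 3
      then have x': "x \<in> C" "p x" and V: "\<And>z. z \<in> C \<Longrightarrow> \<not> p z \<Longrightarrow> x < z \<Longrightarrow> z \<in> V"
        using S by (auto simp: free_points_def)
      \<comment> \<open>If \<open>y\<close> has the other colour, \<open>z\<close> is
        \<open>y\<close> itself; otherwise \<open>between\<close> supplies it. Freeness of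
        \<open>x\<close> puts \<open>z\<close> into \<open>V\<close>, and this forces
        \<open>y\<close>.\<close>
      obtain z where "z \<in> C" "\<not> p z" "x < z" "z \<le> y"
        using between[OF x'(1) y(1) 3(2) x'(2)] 3(2) y(1) by (cases "p y") (auto simp: order_less_imp_le)
      then show ?thesis using V B[of z y] y U by auto
    qed
  qed
  moreover have "U \<subseteq> C"
    using sub S by (auto simp: U B_def V_def free_points_def)
  moreover have "{x \<in> U. \<not> p x} = V"
    using S by (auto simp: U B_def V_def free_points_def)
  ultimately show "U \<in> {U \<in> upsets C. {x \<in> U. \<not> p x} = V}" by (simp add: upsets_def)
qed

text \<open>Within a fibre only the set \<open>S\<close> of chosen free points varies, and balance
  prescribes its size. So the balanced members number at most one binomial coefficient, out of
  \<open>2 ^ card F\<close>.\<close>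

lemma card_balanced_fibre:
  assumes fin: "finite C" and U0: "U0 \<in> upsets C"
    and between: "\<And>x y. \<lbrakk>x \<in> C; y \<in> C; x < y; p x; p y\<rbrakk> \<Longrightarrow> \<exists>z\<in>C. \<not> p z \<and> x < z \<and> z < y"
  defines "V \<equiv> {x \<in> U0. \<not> p x}"
  assumes M: "M \<le> card (free_points C p V)"
  shows "real (card {U \<in> upsets C. {x \<in> U. \<not> p x} = V \<and> balanced p U})
    \<le> central_ratio M * real (card {U \<in> upsets C. {x \<in> U. \<not> p x} = V})"
proof -
  define G where "G = {x \<in> C. p x \<and> (\<exists>y\<in>V. y < x)}"
  define F where "F = free_points C p V"
  have VC: "V \<subseteq> C" "\<And>x. x \<in> V \<Longrightarrow> \<not> p x" using U0 by (auto simp: upsets_def V_def)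
  have F: "F \<subseteq> C" "\<And>x. x \<in> F \<Longrightarrow> p x" "F \<inter> G = {}"
    using VC by (auto simp: F_def G_def free_points_def)
  have finF: "finite F" "finite G" using fin F finite_subset by (auto simp: G_def)
  have fibre: "{U \<in> upsets C. {x \<in> U. \<not> p x} = V} = (\<lambda>S. (V \<union> G) \<union> S) ` Pow F"
    using upset_fibre[OF U0, of p] between by (simp only: V_def F_def G_def)
  have inj: "inj_on (\<lambda>S. (V \<union> G) \<union> S) (Pow F)"
    using F VC by (intro inj_onI) blast
  have "{U \<in> upsets C. {x \<in> U. \<not> p x} = V \<and> balanced p U}
      \<subseteq> (\<lambda>S. (V \<union> G) \<union> S) ` {S. S \<subseteq> F \<and> card S = card V - card G}"
  proof
    fix U assume "U \<in> {U \<in> upsets C. {x \<in> U. \<not> p x} = V \<and> balanced p U}"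
    then have "U \<in> {U \<in> upsets C. {x \<in> U. \<not> p x} = V}" and bal: "balanced p U"
      and V: "{x \<in> U. \<not> p x} = V" by auto
    then obtain S where S: "S \<subseteq> F" and U: "U = (V \<union> G) \<union> S" unfolding fibre by auto
    have "{x \<in> U. p x} = G \<union> S" using S F VC by (auto simp: U G_def)
    moreover have "card (G \<union> S) = card G + card S"
      using S F finF by (intro card_Un_disjoint) (auto intro: finite_subset)
    \<comment> \<open>Balance gives \<open>card V = card G + card S\<close>, so the truncated
      subtraction is exact here. If \<open>card V < card G\<close>, no member of the fibre is
      balanced and the upper bound still holds.\<close>
    ultimately have "card S = card V - card G" using bal V by (simp add: balanced_def)
    then show "U \<in> (\<lambda>S. (V \<union> G) \<union> S) ` {S. S \<subseteq> F \<and> card S = card V - card G}"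
      using S U by auto
  qed
  then have "card {U \<in> upsets C. {x \<in> U. \<not> p x} = V \<and> balanced p U}
      \<le> card {S. S \<subseteq> F \<and> card S = card V - card G}"
    using finF by (intro surj_card_le) auto
  also have "\<dots> = card F choose (card V - card G)" by (rule n_subsets[OF finF(1)])
  finally have "real (card {U \<in> upsets C. {x \<in> U. \<not> p x} = V \<and> balanced p U})
      \<le> real (card F choose (card V - card G))" by simp
  also have "\<dots> \<le> central_ratio M * 2 ^ card F"
    using M by (intro binomial_le_central_ratio) (simp add: F_def)
  also have "(2::real) ^ card F = real (card {U \<in> upsets C. {x \<in> U. \<not> p x} = V})"
    unfolding fibre card_image[OF inj] card_Pow[OF finF(1)] by simp
  finally show ?thesis .
qed

lemma card_eq_sum_fibres:
  "finite A \<Longrightarrow> card A = (\<Sum>v\<in>g ` A. card {a \<in> A. g a = v})"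
  using sum.image_gen[of A "\<lambda>_. 1::nat" g] by simp

text \<open>The bound for one fibre is summed over all fibres with at least \<open>M\<close> free
  points.\<close>

lemma card_balanced_le:
  assumes fin: "finite C"
    and between: "\<And>x y. \<lbrakk>x \<in> C; y \<in> C; x < y; p x; p y\<rbrakk> \<Longrightarrow> \<exists>z\<in>C. \<not> p z \<and> x < z \<and> z < y"
  shows "real (card {U \<in> upsets C. balanced p U \<and> M \<le> card {x \<in> minimal_elements U. p x}})
    \<le> central_ratio M * real (card (upsets C))"
proof -
  define g where "g U = {x \<in> U. \<not> p x}" for U :: "'a set"
  \<comment> \<open>The threshold is put on free points instead of minimal elements because it then
    depends on \<open>g U\<close> alone, which makes \<open>A\<close> a union of whole
    fibres.\<close>
  define A where "A = {U \<in> upsets C. M \<le> card (free_points C p (g U))}"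
  note finU = finite_upsets[OF fin]
  have finA: "finite A" using finU by (simp add: A_def)
  have "card {x \<in> minimal_elements U. p x} \<le> card (free_points C p (g U))" if "U \<in> upsets C" for U
  proof (rule card_mono)
    show "finite (free_points C p (g U))" using fin by (simp add: free_points_def)
    \<comment> \<open>Below a minimal element nothing lies in \<open>U\<close>, and every point of
      \<open>C\<close> above it does, so neither kind of forcing occurs.\<close>
    show "{x \<in> minimal_elements U. p x} \<subseteq> free_points C p (g U)"
      using that
      by (auto simp: minimal_elements_def free_points_def upsets_def g_def order_less_imp_le)
  qed
  then have "card {U \<in> upsets C. balanced p U \<and> M \<le> card {x \<in> minimal_elements U. p x}}
      \<le> card {U \<in> A. balanced p U}"
    using finU unfolding A_def by (intro card_mono) (auto intro: order_trans)
  also have "\<dots> = (\<Sum>V\<in>g ` {U \<in> A. balanced p U}. card {U \<in> {U \<in> A. balanced p U}. g U = V})"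
    using finA by (intro card_eq_sum_fibres) auto
  also have "\<dots> \<le> (\<Sum>V\<in>g ` A. card {U \<in> {U \<in> A. balanced p U}. g U = V})"
    using finA by (intro sum_mono2) auto
  finally have "real (card {U \<in> upsets C. balanced p U \<and> M \<le> card {x \<in> minimal_elements U. p x}})
      \<le> (\<Sum>V\<in>g ` A. real (card {U \<in> {U \<in> A. balanced p U}. g U = V}))"
    by (simp only: of_nat_le_iff flip: of_nat_sum)
  also have "\<dots> \<le> (\<Sum>V\<in>g ` A. central_ratio M * real (card {U \<in> A. g U = V}))"
  proof (rule sum_mono)
    fix V assume "V \<in> g ` A"
    then obtain U0 where U0: "U0 \<in> upsets C" "V = g U0" "M \<le> card (free_points C p V)"
      by (auto simp: A_def)
    have "{U \<in> {U \<in> A. balanced p U}. g U = V} = {U \<in> upsets C. g U = V \<and> balanced p U}"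
      "{U \<in> A. g U = V} = {U \<in> upsets C. g U = V}"
      using U0(3) by (auto simp: A_def)
    then show "real (card {U \<in> {U \<in> A. balanced p U}. g U = V})
        \<le> central_ratio M * real (card {U \<in> A. g U = V})"
      using card_balanced_fibre[OF fin U0(1), of p M] between U0(2,3) by (simp add: g_def)
  qed
  also have "\<dots> = central_ratio M * real (card A)"
    using card_eq_sum_fibres[OF finA, of g] by (simp flip: sum_distrib_left)
  also have "\<dots> \<le> central_ratio M * real (card (upsets C))"
    using finU by (intro mult_left_mono of_nat_mono card_mono) (auto simp: A_def central_ratio_def)
  finally show ?thesis .
qed

section \<open>Counting upsets by minimal elements and by antichains\<close>

text \<open>Each point of a finite upset lies above a minimal one. Used in both directions, this
  shows that the minimal elements determine the upset.\<close>

lemma upset_subset_if_minimal_elements_eq: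
  assumes fin: "finite C" and U: "U \<in> upsets C" and V: "V \<in> upsets C"
    and eq: "minimal_elements U = minimal_elements V"
  shows "U \<subseteq> V"
proof
  fix x assume x: "x \<in> U"
  have "finite U" using fin U finite_subset by (auto simp: upsets_def)
  then obtain m where m: "m \<in> U" "m \<le> x" "\<And>y. y \<in> U \<Longrightarrow> y \<le> m \<Longrightarrow> m = y"
    using finite_has_minimal2[OF _ x] by blast
  then have "m \<in> minimal_elements U" by (auto simp: minimal_elements_def less_le_not_le)
  then have "m \<in> V" using eq by (auto simp: minimal_elements_def)
  then show "x \<in> V" using m(2) x U V by (auto simp: upsets_def)
qed

lemma card_few_minimal_elements_le:
  assumes fin: "finite C"
  shows "card {U \<in> upsets C. card (minimal_elements U) < K} \<le> K * Suc (card C) ^ K"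
proof -
  let ?A = "{U \<in> upsets C. card (minimal_elements U) < K}"
  have inj: "inj_on minimal_elements ?A"
    using upset_subset_if_minimal_elements_eq[OF fin] by (intro inj_onI) (auto 4 4)
  have "card ?A = card (minimal_elements ` ?A)" using card_image[OF inj] by simp
  also have "\<dots> \<le> card (\<Union>j<K. {S. S \<subseteq> C \<and> card S = j})"
    using fin by (intro card_mono) (auto simp: minimal_elements_def upsets_def)
  also have "\<dots> \<le> (\<Sum>j<K. card {S. S \<subseteq> C \<and> card S = j})"
    by (intro card_UN_le) simp
  also have "\<dots> = (\<Sum>j<K. card C choose j)" by (simp add: n_subsets[OF fin])
  also have "\<dots> \<le> (\<Sum>j<K. Suc (card C) ^ K)"
  proof (rule sum_mono)
    fix j assume "j \<in> {..<K}"
    have "card C choose j \<le> card C ^ j"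
      by (cases "j \<le> card C") (auto intro: binomial_le_pow simp: binomial_eq_0)
    \<comment> \<open>A base of at least 1 is what allows the exponent to grow from \<open>j\<close>
      to \<open>K\<close>, also for empty \<open>C\<close>.\<close>
    also have "\<dots> \<le> Suc (card C) ^ j" by (intro power_mono) auto
    also have "\<dots> \<le> Suc (card C) ^ K" using \<open>j \<in> {..<K}\<close> by (intro power_increasing) auto
    finally show "card C choose j \<le> Suc (card C) ^ K" .
  qed
  finally show ?thesis by simp
qed

text \<open>Distinct subsets of an antichain generate distinct upsets: intersecting with
  \<open>A\<close> recovers the subset.\<close>

lemma card_upsets_ge:
  assumes fin: "finite C" and AC: "A \<subseteq> C" and anti: "\<And>x y. \<lbrakk>x \<in> A; y \<in> A\<rbrakk> \<Longrightarrow> \<not> x < y"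
  shows "2 ^ card A \<le> card (upsets C)"
proof -
  let ?up = "\<lambda>S. {y \<in> C. \<exists>x\<in>S. x \<le> y}"
  have "inj_on ?up (Pow A)"
  proof (rule inj_on_inverseI)
    fix S assume "S \<in> Pow A"
    then show "?up S \<inter> A = S"
      using AC anti by (auto simp: order_le_less)
  qed
  moreover have "?up ` Pow A \<subseteq> upsets C" by (auto simp: upsets_def intro: order_trans)
  ultimately have "card (Pow A) \<le> card (upsets C)"
    using finite_upsets[OF fin] by (intro card_inj_on_le)
  then show ?thesis using finite_subset[OF AC fin] by (simp add: card_Pow)
qed

subsection \<open>The cube\<close>

definition weight :: "nat \<Rightarrow> (nat \<Rightarrow> bool) \<Rightarrow> nat" where
  "weight n x = card {i \<in> {..<n}. x i}"

lemma finite_cube: "finite (cube n)"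
  by (simp add: cube_def finite_PiE)

lemma card_cube: "card (cube n) = 2 ^ n"
  by (simp add: cube_def card_funcsetE)

lemma cube_update: "x \<in> cube n \<Longrightarrow> i < n \<Longrightarrow> x(i := b) \<in> cube n"
  by (auto simp: cube_def PiE_iff extensional_def)

lemma weight_update_True:
  assumes "i < n" "\<not> x i"
  shows "weight n (x(i := True)) = Suc (weight n x)"
proof -
  have "{j \<in> {..<n}. (x(i := True)) j} = insert i {j \<in> {..<n}. x j}"
    using assms by auto
  then show ?thesis using assms by (simp add: weight_def)
qed

lemma cube_strict_witness:
  assumes "x \<in> cube n" "y \<in> cube n" "x < y"
  obtains i where "i < n" "\<not> x i" "y i" "x(i := True) \<le> y"
proof -
  obtain i where i: "\<not> x i" "y i" and le: "x \<le> y"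
    using assms(3) by (auto simp: less_le_not_le le_fun_def)
  \<comment> \<open>Points of the cube agree outside \<open>{..<n}\<close> by
    extensionality.\<close>
  then have "i < n" using assms by (auto simp: cube_def PiE_iff extensional_def)
  moreover have "x(i := True) \<le> y" using i le by (auto simp: le_fun_def)
  ultimately show ?thesis using i that by blast
qed

lemma weight_mono: "x \<le> y \<Longrightarrow> weight n x \<le> weight n y"
  unfolding weight_def by (intro card_mono) (auto simp: le_fun_def)

lemma weight_strict_mono:
  assumes "x \<in> cube n" "y \<in> cube n" "x < y"
  shows "weight n x < weight n y"
proof -
  obtain i where "i < n" "\<not> x i" "x(i := True) \<le> y"
    using cube_strict_witness[OF assms] by metis
  then show ?thesis using weight_mono[of "x(i := True)" y n] by (simp add: weight_update_True)
qed

text \<open>Raising one coordinate of \<open>x\<close> changes the parity, so the new point cannot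
  equal \<open>y\<close>. This supplies the \<open>between\<close> hypothesis for both
  parities.\<close>

lemma cube_between:
  assumes xy: "x \<in> cube n" "y \<in> cube n" "x < y" and par: "even (weight n x) = even (weight n y)"
  shows "\<exists>z\<in>cube n. even (weight n z) \<noteq> even (weight n x) \<and> x < z \<and> z < y"
proof -
  obtain i where i: "i < n" "\<not> x i" "x(i := True) \<le> y"
    using cube_strict_witness[OF xy] by metis
  let ?z = "x(i := True)"
  have w: "weight n ?z = Suc (weight n x)" using i by (simp add: weight_update_True)
  have "x < ?z" using i(2) by (auto simp: less_le_not_le le_fun_def)
  moreover have "?z < y" using i(3) w par by (auto simp: order_le_less)
  ultimately show ?thesis using w cube_update[OF xy(1) i(1)] by (intro bexI[of _ ?z]) auto
qed

lemma card_level: "card {x \<in> cube n. weight n x = k} = n choose k"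
proof -
  have "bij_betw (\<lambda>x. {i \<in> {..<n}. x i}) {x \<in> cube n. weight n x = k}
      {S. S \<subseteq> {..<n} \<and> card S = k}"
  proof (rule bij_betw_byWitness[of _ "\<lambda>S. \<lambda>i\<in>{..<n}. i \<in> S"])
    show "\<forall>x\<in>{x \<in> cube n. weight n x = k}. (\<lambda>i\<in>{..<n}. i \<in> {i \<in> {..<n}. x i}) = x"
      by (auto simp: cube_def PiE_iff extensional_def restrict_def fun_eq_iff)
    have "{i \<in> {..<n}. (\<lambda>i\<in>{..<n}. i \<in> S) i} = S" if "S \<subseteq> {..<n}" for S
      using that by auto
    then show "\<forall>S\<in>{S. S \<subseteq> {..<n} \<and> card S = k}. {i \<in> {..<n}. (\<lambda>i\<in>{..<n}. i \<in> S) i} = S"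
      and "(\<lambda>S. \<lambda>i\<in>{..<n}. i \<in> S) ` {S. S \<subseteq> {..<n} \<and> card S = k}
        \<subseteq> {x \<in> cube n. weight n x = k}"
      by (auto simp: weight_def cube_def)
  qed (auto simp: weight_def)
  then show ?thesis using n_subsets[of "{..<n}" k] by (simp add: bij_betw_same_card)
qed

text \<open>Level 2 is an antichain because weight is strictly monotone, and its size is quadratic
  in \<open>n\<close>, enough to beat an exponent linear in \<open>n\<close>.\<close>

lemma card_upsets_cube_ge: "2 ^ (n choose 2) \<le> card (upsets (cube n))"
  using card_upsets_ge[OF finite_cube, of "{x \<in> cube n. weight n x = 2}" n]
    weight_strict_mono[of _ n]
  by (fastforce simp: card_level)

lemma bij_betw_monotone_upsets:
  "bij_betw (\<lambda>f. {x \<in> cube n. f x}) (monotone_boolean_functions n) (upsets (cube n))"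
proof (rule bij_betw_byWitness[of _ "\<lambda>U. \<lambda>x\<in>cube n. x \<in> U"])
  show "\<forall>f\<in>monotone_boolean_functions n. (\<lambda>x\<in>cube n. x \<in> {x \<in> cube n. f x}) = f"
    by (auto simp: monotone_boolean_functions_def boolean_functions_def PiE_iff extensional_def
        restrict_def fun_eq_iff)
  show "\<forall>U\<in>upsets (cube n). {x \<in> cube n. (\<lambda>x\<in>cube n. x \<in> U) x} = U"
    by (auto simp: upsets_def)
  show "(\<lambda>f. {x \<in> cube n. f x}) ` monotone_boolean_functions n \<subseteq> upsets (cube n)"
    by (auto simp: monotone_boolean_functions_def upsets_def mono_on_def)
  show "(\<lambda>U. \<lambda>x\<in>cube n. x \<in> U) ` upsets (cube n) \<subseteq> monotone_boolean_functions n"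
    by (auto simp: monotone_boolean_functions_def boolean_functions_def upsets_def
        intro!: mono_onI)
qed

subsection \<open>Decision trees\<close>

definition parity_sign :: "nat \<Rightarrow> (nat \<Rightarrow> bool) \<Rightarrow> int" where
  "parity_sign n x = (if even (weight n x) then 1 else - 1)"

text \<open>A partial assignment is encoded as a total \<open>y\<close> together with its domain
  \<open>A\<close>; recording an answer means \<open>insert i A\<close> and
  \<open>y(i := b)\<close>.\<close>

definition subcube :: "nat \<Rightarrow> nat set \<Rightarrow> (nat \<Rightarrow> bool) \<Rightarrow> (nat \<Rightarrow> bool) set" where
  "subcube n A y = {x \<in> cube n. \<forall>i\<in>A. x i = y i}"

lemma finite_subcube: "finite (subcube n A y)"
  using finite_cube by (simp add: subcube_def)

text \<open>Flipping a coordinate outside \<open>A\<close> is an involution of the subcube that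
  reverses signs.\<close>

lemma sum_parity_sign_subcube:
  assumes "finite A" "card A < n"
  shows "(\<Sum>x\<in>subcube n A y. parity_sign n x) = 0"
proof -
  obtain i where i: "i < n" "i \<notin> A"
    using assms card_mono[OF assms(1), of "{..<n}"] by fastforce
  let ?flip = "\<lambda>x::nat \<Rightarrow> bool. x(i := \<not> x i)"
  have sign: "parity_sign n (?flip x) = - parity_sign n x" for x
  proof (cases "x i")
    case True
    then have "\<not> ?flip x i" and x: "(?flip x)(i := True) = x" by (auto simp: fun_eq_iff)
    from weight_update_True[of i n "?flip x", OF i(1) this(1)] show ?thesis
      unfolding x by (simp add: parity_sign_def)
  next
    case False
    then show ?thesis using weight_update_True[OF i(1), of x] by (simp add: parity_sign_def)
  qed
  have flip: "?flip x \<in> subcube n A y" if "x \<in> subcube n A y" for x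
    using that i cube_update[of x n i] by (auto simp: subcube_def)
  have "(\<Sum>x\<in>subcube n A y. parity_sign n x) = (\<Sum>x\<in>subcube n A y. - parity_sign n x)"
    by (rule sum.reindex_bij_witness[of _ ?flip ?flip]) (use flip sign in auto)
  then show ?thesis by (simp add: sum_negf)
qed

text \<open>\<open>A\<close> and \<open>y\<close> record the answers received so far. At a leaf some
  coordinate is still open, so the signs cancel; at a query of a new coordinate the subcube splits
  into two.\<close>

lemma sum_run_parity_sign_subcube:
  assumes "finite A" "\<And>x. x \<in> subcube n A y \<Longrightarrow> card A + num_queries T x < n"
  shows "(\<Sum>x\<in>subcube n A y. if run T x then parity_sign n x else 0) = 0"
  using assms
proof (induction T arbitrary: A y)
  case (Answer b)
  show ?case
  \<comment> \<open>On an empty subcube the hypothesis says nothing about \<open>card A\<close>, but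
    the sum is empty.\<close>
  proof (cases "subcube n A y = {}")
    case False
    then have "card A < n" using Answer.prems(2) by auto
    from sum_parity_sign_subcube[OF Answer.prems(1) this] show ?thesis by (cases b) simp_all
  qed simp
next
  case (Query i T0 T1)
  let ?s = "\<lambda>T x. if run T x then parity_sign n x else 0"
  define T' where "T' b = (if b then T1 else T0)" for b
  have IH: "(\<Sum>x\<in>subcube n B z. ?s (T' b) x) = 0"
    if "finite B" "\<And>x. x \<in> subcube n B z \<Longrightarrow> card B + num_queries (T' b) x < n" for b B z
    using Query.IH that by (cases b) (auto simp: T'_def)
  have run: "run (Query i T0 T1) x = run (T' b) x"
    and num: "num_queries (Query i T0 T1) x = Suc (num_queries (T' b) x)" if "x i = b" for x b
    using that by (auto simp: T'_def)
  show ?case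
  \<comment> \<open>A repeated query has a known answer: the subcube stays the same and only one
    branch is followed.\<close>
  proof (cases "i \<in> A")
    case True
    then have xi: "x i = y i" if "x \<in> subcube n A y" for x
      using that by (auto simp: subcube_def)
    have "(\<Sum>x\<in>subcube n A y. ?s (Query i T0 T1) x) = (\<Sum>x\<in>subcube n A y. ?s (T' (y i)) x)"
      by (rule sum.cong[OF refl]) (simp only: run xi)
    also have "\<dots> = 0"
    proof (rule IH)
      fix x assume x: "x \<in> subcube n A y"
      show "card A + num_queries (T' (y i)) x < n"
        using Query.prems(2)[OF x] num[of x "y i", OF xi[OF x]] by simp
    qed (rule Query.prems)
    finally show ?thesis .
  next
    case False
    let ?S = "\<lambda>b. subcube n (insert i A) (y(i := b))"
    have split: "subcube n A y = ?S True \<union> ?S False"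
      using False by (auto simp: subcube_def)
    have xi: "x i = b" if "x \<in> ?S b" for x b
      using that by (simp add: subcube_def)
    have zero: "(\<Sum>x\<in>?S b. ?s (Query i T0 T1) x) = 0" for b
    proof -
      have "(\<Sum>x\<in>?S b. ?s (Query i T0 T1) x) = (\<Sum>x\<in>?S b. ?s (T' b) x)"
        by (rule sum.cong[OF refl]) (simp only: run xi)
      also have "\<dots> = 0"
      proof (rule IH)
        fix x assume x: "x \<in> ?S b"
        then have "x \<in> subcube n A y" using split by (cases b) auto
        from Query.prems(2)[OF this] show "card (insert i A) + num_queries (T' b) x < n"
          using num[of x b, OF xi[OF x]] False Query.prems(1) by simp
      qed (use Query.prems in simp)
      finally show ?thesis .
    qed
    have "?S True \<inter> ?S False = {}" by (auto simp: subcube_def)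
    then show ?thesis
      unfolding split using zero[of True] zero[of False]
      by (subst sum.union_disjoint) (auto simp: finite_subcube)
  qed
qed

lemma balanced_if_few_queries:
  assumes T: "computes n T f" and few: "\<And>x. x \<in> cube n \<Longrightarrow> num_queries T x < n"
  shows "balanced (\<lambda>x. even (weight n x)) {x \<in> cube n. f x}"
proof -
  let ?U = "{x \<in> cube n. f x}"
  have fin: "finite ?U" using finite_cube by simp
  have "subcube n {} undefined = cube n" by (simp add: subcube_def)
  then have "0 = (\<Sum>x\<in>cube n. if run T x then parity_sign n x else 0)"
    using sum_run_parity_sign_subcube[of "{}" n undefined T] few by simp
  also have "\<dots> = (\<Sum>x\<in>cube n. if f x then parity_sign n x else 0)"
    using T by (intro sum.cong) (auto simp: computes_def)
  also have "\<dots> = (\<Sum>x\<in>?U. parity_sign n x)"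
    by (rule sum.inter_filter[symmetric, OF finite_cube])
  also have "\<dots> = int (card {x \<in> ?U. even (weight n x)}) - int (card {x \<in> ?U. odd (weight n x)})"
    using fin by (simp add: parity_sign_def sum.If_cases sum_negf Int_def)
  finally show ?thesis by (simp add: balanced_def)
qed

text \<open>The coordinates are queried from \<open>m - 1\<close> downwards; \<open>g\<close> is generalised so that it can absorb the
  answers received so far.\<close>

lemma full_tree_exists:
  "\<exists>T. queried_vars T \<subseteq> {..<m} \<and> (\<forall>x. num_queries T x = m \<and> run T x = g (restrict x {..<m}))"
proof (induction m arbitrary: g)
  case 0
  show ?case
    by (rule exI[of _ "Answer (g (restrict undefined {}))"]) (auto simp: restrict_def)
next
  case (Suc m)
  have "\<exists>T. queried_vars T \<subseteq> {..<m} \<and>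
      (\<forall>x. num_queries T x = m \<and> run T x = g ((restrict x {..<m})(m := b)))" for b
    using Suc.IH[of "\<lambda>x. g (x(m := b))"] .
  then obtain T where T: "queried_vars (T b) \<subseteq> {..<m}" "num_queries (T b) x = m"
    "run (T b) x = g ((restrict x {..<m})(m := b))" for b x by metis
  have upd: "(restrict x {..<m})(m := b) = restrict x {..<Suc m}" if "x m = b" for x b
    using that by (auto simp: restrict_def fun_eq_iff less_Suc_eq)
  show ?case
  proof (rule exI[of _ "Query m (T False) (T True)"], intro conjI allI)
    show "queried_vars (Query m (T False) (T True)) \<subseteq> {..<Suc m}"
      using T(1)[of True] T(1)[of False] by auto
  next
    fix x
    show "num_queries (Query m (T False) (T True)) x = Suc m" by (simp add: T(2))
    show "run (Query m (T False) (T True)) x = g (restrict x {..<Suc m})"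
      using upd[of x True] upd[of x False] by (cases "x m") (simp_all only: run.simps T(3) if_True if_False)
  qed
qed

text \<open>The full tree shows that the infimum is attained and at most \<open>n\<close>; without
  evasiveness an optimal tree therefore always stops before \<open>n\<close> queries.\<close>

lemma balanced_if_not_evasive:
  assumes "\<not> evasive n f"
  shows "balanced (\<lambda>x. even (weight n x)) {x \<in> cube n. f x}"
proof -
  let ?W = "worst_case_queries n ` {T. computes n T f}"
  have ne: "cube n \<noteq> {}" by (simp add: cube_def PiE_eq_empty_iff)
  have restr: "restrict x {..<n} = x" if "x \<in> cube n" for x
    using that by (simp add: cube_def PiE_def extensional_restrict)
  obtain T where T: "queried_vars T \<subseteq> {..<n}" "\<And>x. num_queries T x = n"
    "\<And>x. run T x = f (restrict x {..<n})"
    using full_tree_exists[of n f] by blast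
  have comp: "computes n T f" using T restr by (simp add: computes_def)
  have "num_queries T ` cube n = {n}" using ne T(2) by auto
  then have "worst_case_queries n T = n" by (simp add: worst_case_queries_def)
  then have "n \<in> ?W" using comp by force
  then have "Inf ?W \<in> ?W" "Inf ?W \<le> n" by (auto intro: Inf_nat_def1 cInf_lower)
  moreover have "Inf ?W \<noteq> n" using assms by (simp add: evasive_def decision_tree_complexity_def)
  ultimately obtain T' where T': "computes n T' f" "worst_case_queries n T' < n" by auto
  have "num_queries T' x < n" if "x \<in> cube n" for x
    using T'(2) that finite_cube[of n]
    by (auto simp: worst_case_queries_def intro: le_less_trans[OF Max_ge])
  then show ?thesis using balanced_if_few_queries[OF T'(1)] by blast
qed

subsection \<open>Counting\<close>

lemma balanced_not_iff: "balanced (\<lambda>x. \<not> p x) U \<longleftrightarrow> balanced p U"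
  by (auto simp: balanced_def)

text \<open>Among \<open>2 * M\<close> minimal elements at least \<open>M\<close> share a parity,
  but which one depends on the function. Hence the fibre bound is used once for each parity, giving
  the factor 2.\<close>

lemma card_not_evasive_le:
  "real (card {f \<in> monotone_boolean_functions n. \<not> evasive n f})
    \<le> 2 * central_ratio M * real (card (monotone_boolean_functions n))
      + real (2 * M * Suc (2 ^ n) ^ (2 * M))"
proof -
  let ?C = "cube n" and ?U = "\<lambda>f. {x \<in> cube n. f x}"
  define p where "p x \<longleftrightarrow> even (weight n x)" for x
  let ?bal = "\<lambda>q. {U \<in> upsets ?C. balanced q U \<and> M \<le> card {x \<in> minimal_elements U. q x}}"
  let ?few = "{U \<in> upsets ?C. card (minimal_elements U) < 2 * M}"
  note finU = finite_upsets[OF finite_cube, of n]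
  have total: "card (monotone_boolean_functions n) = card (upsets ?C)"
    by (rule bij_betw_same_card[OF bij_betw_monotone_upsets])
  have dichotomy: "M \<le> card {x \<in> minimal_elements U. p x} \<or>
      M \<le> card {x \<in> minimal_elements U. \<not> p x}"
    if "U \<in> upsets ?C" "2 * M \<le> card (minimal_elements U)" for U
  proof -
    have "finite (minimal_elements U)"
      using that(1) by (auto simp: minimal_elements_def upsets_def intro: finite_subset[OF _ finite_cube])
    then have "card (minimal_elements U)
        = card {x \<in> minimal_elements U. p x} + card {x \<in> minimal_elements U. \<not> p x}"
      by (subst card_Un_disjoint[symmetric]) (auto intro: arg_cong[of _ _ card])
    then show ?thesis using that(2) by linarith
  qed
  have inj: "inj_on ?U {f \<in> monotone_boolean_functions n. \<not> evasive n f}"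
    by (rule inj_on_subset[OF bij_betw_imp_inj_on[OF bij_betw_monotone_upsets]]) auto
  have "?U ` {f \<in> monotone_boolean_functions n. \<not> evasive n f}
      \<subseteq> ?bal p \<union> ?bal (\<lambda>x. \<not> p x) \<union> ?few"
  proof
    fix U assume "U \<in> ?U ` {f \<in> monotone_boolean_functions n. \<not> evasive n f}"
    then have "U \<in> upsets ?C" "balanced p U"
      using balanced_if_not_evasive bij_betw_imp_surj_on[OF bij_betw_monotone_upsets, of n]
      by (auto simp: p_def[abs_def])
    then show "U \<in> ?bal p \<union> ?bal (\<lambda>x. \<not> p x) \<union> ?few"
      using dichotomy[of U] by (auto simp: balanced_not_iff)
  qed
  then have "card {f \<in> monotone_boolean_functions n. \<not> evasive n f}
      \<le> card (?bal p \<union> ?bal (\<lambda>x. \<not> p x) \<union> ?few)"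
    using finU by (intro card_inj_on_le[OF inj]) auto
  also have "\<dots> \<le> card (?bal p) + card (?bal (\<lambda>x. \<not> p x)) + card ?few"
    using card_Un_le[of "?bal p \<union> ?bal (\<lambda>x. \<not> p x)" ?few]
      card_Un_le[of "?bal p" "?bal (\<lambda>x. \<not> p x)"] by linarith
  finally have "real (card {f \<in> monotone_boolean_functions n. \<not> evasive n f})
      \<le> real (card (?bal p)) + real (card (?bal (\<lambda>x. \<not> p x))) + real (card ?few)"
    by linarith
  moreover have "real (card (?bal p)) \<le> central_ratio M * real (card (upsets ?C))"
    using cube_between[of _ n] by (intro card_balanced_le finite_cube) (auto simp: p_def)
  moreover have "real (card (?bal (\<lambda>x. \<not> p x))) \<le> central_ratio M * real (card (upsets ?C))"
    using cube_between[of _ n] by (intro card_balanced_le finite_cube) (auto simp: p_def)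
  moreover have "card ?few \<le> 2 * M * Suc (2 ^ n) ^ (2 * M)"
    using card_few_minimal_elements_le[OF finite_cube, of n "2 * M"] by (simp only: card_cube)
  then have "real (card ?few) \<le> real (2 * M * Suc (2 ^ n) ^ (2 * M))"
    by (rule of_nat_mono)
  ultimately show ?thesis unfolding total by linarith
qed

section \<open>Asymptotics\<close>

lemma few_minimal_elements_negligible:
  "(\<lambda>n. real (K * Suc (2 ^ n) ^ K) / 2 ^ (n choose 2)) \<longlonglongrightarrow> 0"
proof (rule tendsto_sandwich[OF _ _ tendsto_const])
  show "\<forall>\<^sub>F n in sequentially. 0 \<le> real (K * Suc (2 ^ n) ^ K) / 2 ^ (n choose 2)" by simp
  show "(\<lambda>n. real K * (1 / 2) ^ n) \<longlonglongrightarrow> 0"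
    by (intro tendsto_mult_right_zero LIMSEQ_power_zero) simp
  show "\<forall>\<^sub>F n in sequentially. real (K * Suc (2 ^ n) ^ K) / 2 ^ (n choose 2) \<le> real K * (1 / 2) ^ n"
    \<comment> \<open>From \<open>4 * K + 3\<close> on, n - 1 >= 2(2K + 1), so
      \<open>n * (2 * K + 1) \<le> n choose 2\<close>. Here \<open>n * (2 * K)\<close> pays for the
      numerator and the remaining \<open>n\<close> is the decay.\<close>
    using eventually_ge_at_top[of "4 * K + 3"]
  proof eventually_elim
    case (elim n)
    have "Suc (2 ^ n) ^ K \<le> (2 ^ (2 * n)) ^ K"
    proof (rule power_mono)
      have "Suc (2 ^ n) \<le> 2 ^ Suc n" by simp
      also have "(2::nat) ^ Suc n \<le> 2 ^ (2 * n)" using elim by (intro power_increasing) auto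
      finally show "Suc (2 ^ n) \<le> 2 ^ (2 * n)" .
    qed simp
    also have "(2 ^ (2 * n)) ^ K = (2::nat) ^ (n * (2 * K))" by (simp add: mult_ac flip: power_mult)
    finally have "Suc (2 ^ n) ^ K * 2 ^ n \<le> 2 ^ (n * (2 * K)) * 2 ^ n" by simp
    also have "\<dots> = 2 ^ (n * (2 * K + 1))" by (simp add: power_add)
    also have "\<dots> \<le> 2 ^ (n choose 2)"
    proof (rule power_increasing)
      have "n * ((2 * K + 1) * 2) \<le> n * (n - 1)" using elim by (intro mult_le_mono2) simp
      then have "n * (2 * K + 1) * 2 \<le> n * (n - 1)" by (simp only: mult.assoc)
      then show "n * (2 * K + 1) \<le> n choose 2" unfolding choose_two by linarith
    qed simp
    finally have "real (Suc (2 ^ n) ^ K * 2 ^ n) \<le> real (2 ^ (n choose 2))" by (rule of_nat_mono)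
    then have "real (Suc (2 ^ n) ^ K) / 2 ^ (n choose 2) \<le> (1 / 2) ^ n"
      by (simp add: field_simps power_one_over)
    from mult_left_mono[OF this, of "real K"] show ?case by simp
  qed
qed

theorem corollary19:
  shows "(\<lambda>n. real (card {f \<in> monotone_boolean_functions n. evasive n f}) /
              real (card (monotone_boolean_functions n))) \<longlonglongrightarrow> 1"
proof -
  define N where "N n = real (card (monotone_boolean_functions n))" for n
  define R where "R n = real (card {f \<in> monotone_boolean_functions n. \<not> evasive n f}) / N n" for n
  have N_ge: "2 ^ (n choose 2) \<le> N n" for n
  proof -
    have "2 ^ (n choose 2) \<le> card (monotone_boolean_functions n)"
      using card_upsets_cube_ge[of n] bij_betw_same_card[OF bij_betw_monotone_upsets, of n] by simp
    from of_nat_mono[OF this, where 'a = real] show ?thesis by (simp add: N_def)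
  qed
  have N_pos: "0 < N n" for n by (rule less_le_trans[OF _ N_ge]) simp
  have bound: "R n \<le> 2 * central_ratio M + real (2 * M * Suc (2 ^ n) ^ (2 * M)) / 2 ^ (n choose 2)"
    for n M
  proof -
    have "R n \<le> (2 * central_ratio M * N n + real (2 * M * Suc (2 ^ n) ^ (2 * M))) / N n"
      unfolding R_def N_def by (intro divide_right_mono card_not_evasive_le) simp
    also have "\<dots> = 2 * central_ratio M + real (2 * M * Suc (2 ^ n) ^ (2 * M)) / N n"
      using N_pos[of n] by (simp add: add_divide_distrib)
    also have "\<dots> \<le> 2 * central_ratio M + real (2 * M * Suc (2 ^ n) ^ (2 * M)) / 2 ^ (n choose 2)"
      using N_ge by (intro add_left_mono divide_left_mono) (auto simp: N_pos)
    finally show ?thesis .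
  qed
  have "R \<longlonglongrightarrow> 0"
  proof (rule order_tendstoI)
    fix a :: real assume "a < 0"
    then show "\<forall>\<^sub>F n in sequentially. a < R n"
      by (intro always_eventually allI) (auto simp: R_def N_def intro: less_le_trans)
  next
    fix e :: real assume "0 < e"
    \<comment> \<open>\<open>M\<close> is fixed before \<open>n\<close> grows: the two balance terms
      cost less than e / 2 for every \<open>n\<close>, and the term for few minimal elements falls
      below e / 2 eventually.\<close>
    then obtain M where M: "central_ratio M < e / 4" using central_ratio_small[of "e / 4"] by auto
    have "\<forall>\<^sub>F n in sequentially. real (2 * M * Suc (2 ^ n) ^ (2 * M)) / 2 ^ (n choose 2) < e / 2"
      using \<open>0 < e\<close> by (intro order_tendstoD(2)[OF few_minimal_elements_negligible]) simp
    then show "\<forall>\<^sub>F n in sequentially. R n < e"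
    proof eventually_elim
      case (elim n)
      then show ?case using bound[of n M] M by linarith
    qed
  qed
  moreover have "real (card {f \<in> monotone_boolean_functions n. evasive n f}) / N n = 1 - R n" for n
  proof -
    have fin: "finite (monotone_boolean_functions n)"
      by (simp add: bij_betw_finite[OF bij_betw_monotone_upsets] finite_upsets finite_cube)
    have "{f \<in> monotone_boolean_functions n. evasive n f} \<union>
        {f \<in> monotone_boolean_functions n. \<not> evasive n f} = monotone_boolean_functions n" by auto
    then have "card (monotone_boolean_functions n) =
        card {f \<in> monotone_boolean_functions n. evasive n f} +
        card {f \<in> monotone_boolean_functions n. \<not> evasive n f}"
      using fin by (subst card_Un_disjoint[symmetric]) auto
    then show ?thesis using N_pos[of n] by (simp add: R_def N_def field_simps)
  qed
  ultimately show ?thesis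
    using tendsto_diff[OF tendsto_const, of R 0 sequentially 1] by (simp add: N_def)
qed

end
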